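(* For every positive integer $n$ there is a set $A \subset \mathbb{F}_3^n$ such that for every subspace $V \leq \mathbb{F}_3^n$ of positive dimension, \[ \sup_{r \in \mathbb{F}_3^n,\ r \notin V^{\perp}} \Big| \frac{1}{|V|}\sum_{x \in V} 1_A(x)\, e^{-2\pi i (r\cdot x)/3} \Big| \geq \frac{\sqrt{3}}{6}. \]
   Context: $\mathbb{F}_3^n$ is identified with its dual via the dot product $r\cdot x = \sum_i r_i x_i \in \mathbb{F}_3$, and $e^{-2\pi i (r\cdot x)/3}$ is computed using any integer representative of $r\cdot x$. $V^{\perp} = \{ r : r\cdot v = 0 \text{ for all } v \in V\}$. The quantity inside the absolute value is the Fourier transform at $r$ of $1_A\mu_V$, where $\mu_V$ is the uniform probability measure on $V$. *)

theory Defs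
  imports "HOL-Analysis.Analysis" "Berlekamp_Zassenhaus.Finite_Field"
begin

text \<open>
  An index type with three elements. Its only purpose is to make the library's prime field
  \<open>'p mod_ring\<close> (integers modulo \<open>CARD('p)\<close>) available for the modulus 3; the numeral
  type \<open>3\<close> itself is only a commutative ring, not an instance of class \<open>field\<close>.
\<close>

typedef three = "{..<3::nat}"
  by (rule exI[of _ 0]) simp

lemma CARD_three: "CARD(three) = 3"
  using type_definition.card[OF type_definition_three] by simp

instance three :: prime_card
  by standard (simp add: CARD_three)

type_synonym F3 = "three mod_ring"

definition dot :: "F3 ^ 'n \<Rightarrow> F3 ^ 'n \<Rightarrow> F3" (infixl "\<bullet>\<^sub>3" 70)
  where "r \<bullet>\<^sub>3 x = (\<Sum>i\<in>UNIV. r $ i * x $ i)"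

definition perp :: "(F3 ^ 'n) set \<Rightarrow> (F3 ^ 'n) set"
  where "perp V = {r. \<forall>v\<in>V. r \<bullet>\<^sub>3 v = 0}"

text \<open>
  The Fourier transform of \<open>1\<^sub>A \<mu>\<^sub>V\<close> at \<open>r\<close>, where \<open>\<mu>\<^sub>V\<close> is the uniform probability measure
  on \<open>V\<close>. The function \<open>to_int_mod_ring\<close> picks the representative in \<open>{0, 1, 2}\<close>; the
  exponential does not depend on this choice.
\<close>

definition fourier_restr :: "(F3 ^ 'n) set \<Rightarrow> (F3 ^ 'n) set \<Rightarrow> F3 ^ 'n \<Rightarrow> complex"
  where "fourier_restr A V r =
    1 / of_nat (card V) *
      (\<Sum>x\<in>V. indicator A x *
        exp (- 2 * of_real pi * \<i> * of_int (to_int_mod_ring (r \<bullet>\<^sub>3 x)) / 3))"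

end

(* Let A consist of the vectors whose first nonzero coordinate is 1, and let i be the first
   coordinate that does not vanish identically on V.  In the coefficient at the i-th basis vector,
   the x with x $ i = 0 contribute real terms, those with x $ i = 2 lie outside A, and those with
   x $ i = 1, a third of V, lie in A.  The imaginary part is therefore -(1/3)(sqrt 3 / 2). *)
theory Submission
  imports Defs
begin

lemma Im_exp_third: "Im (exp (- 2 * of_real pi * \<i> / 3)) = - sqrt 3 / 2"
proof -
  have "- 2 * of_real pi * \<i> / 3 = \<i> * of_real (- (2 * pi / 3))"
    by simp
  then have "exp (- 2 * of_real pi * \<i> / 3) = cis (- (2 * pi / 3))"
    by (simp only: cis_conv_exp)
  then show ?thesis
    by (simp add: sin_120)
qed

text \<open>With \<open>axis i 1\<close> as frequency, the character sees only the coordinate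
  \<open>x $ i\<close>.\<close>

lemma axis_dot: "axis i 1 \<bullet>\<^sub>3 x = x $ i"
proof -
  have "axis i 1 \<bullet>\<^sub>3 x = (\<Sum>j\<in>UNIV. if j = i then x $ j else 0)"
    unfolding dot_def by (rule sum.cong) (auto simp: axis_def)
  then show ?thesis
    by simp
qed

text \<open>Rescaling \<open>v\<close> gives some \<open>w\<close> in \<open>V\<close> with
  \<open>w $ i = 1\<close>. Translation by a multiple of \<open>w\<close> preserves \<open>V\<close>
  and carries any fibre of the \<open>i\<close>-th coordinate bijectively onto any other, so all
  fibres have the same size.\<close>

lemma card_subspace_coordinate_fibre:
  fixes V :: "('a::{field, finite} ^ 'n::finite) set"
  assumes V: "vec.subspace V" and "v \<in> V" "v $ i \<noteq> 0"
  shows "card V = CARD('a) * card {x \<in> V. x $ i = d}"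
proof -
  define w where "w = inverse (v $ i) *s v"
  have w: "w \<in> V" "w $ i = 1"
    using assms by (auto simp: w_def vec.subspace_scale)
  have shift: "x + c *s w \<in> V" if "x \<in> V" for x c
    using that w V by (simp add: vec.subspace_add vec.subspace_scale)
  have shift_back: "x + (a - b) *s w + (b - a) *s w = x" for x a b
    by (simp add: vec_eq_iff algebra_simps)
  have maps: "(\<lambda>x. x + (b - a) *s w) \<in> {x \<in> V. x $ i = a} \<rightarrow> {x \<in> V. x $ i = b}" for a b
  proof
    fix x assume "x \<in> {x \<in> V. x $ i = a}"
    then show "x + (b - a) *s w \<in> {x \<in> V. x $ i = b}"
      using shift[of x "b - a"] w by simp
  qed
  have "bij_betw (\<lambda>x. x + (d - c) *s w) {x \<in> V. x $ i = c} {x \<in> V. x $ i = d}" for c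
    by (rule bij_betwI[OF maps maps]) (rule shift_back)+
  then have fibre: "card {x \<in> V. x $ i = c} = card {x \<in> V. x $ i = d}" for c
    by (rule bij_betw_same_card)
  have "card V = (\<Sum>c\<in>UNIV. card {x \<in> V. x $ i = c})"
    using sum_fun_comp[of V UNIV "\<lambda>x. x $ i" "\<lambda>_. 1 :: nat"] by simp
  also have "\<dots> = (\<Sum>c\<in>(UNIV :: 'a set). card {x \<in> V. x $ i = d})"
    by (rule sum.cong[OF refl fibre])
  finally show ?thesis
    by simp
qed

theorem theorem2p1:
  shows "\<exists>A :: (F3 ^ 'n::finite) set.
           \<forall>V :: (F3 ^ 'n) set. vec.subspace V \<and> vec.dim V > 0 \<longrightarrow>
             (SUP r \<in> {r. r \<notin> perp V}. cmod (fourier_restr A V r)) \<ge> sqrt 3 / 6"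
proof -
  \<comment> \<open>The index type \<open>'n\<close> carries no order, so "first coordinate" is
    understood via an injection into the naturals.\<close>
  obtain f :: "'n \<Rightarrow> nat" where f: "inj f"
    using finite_imp_inj_to_nat_seg[OF finite[of UNIV]] by blast
  define A :: "(F3 ^ 'n) set"
    where "A = {x. \<exists>i. x $ i = 1 \<and> (\<forall>j. f j < f i \<longrightarrow> x $ j = 0)}"
  have "sqrt 3 / 6 \<le> (SUP r \<in> {r. r \<notin> perp V}. cmod (fourier_restr A V r))"
    if V: "vec.subspace V" and dim: "vec.dim V > 0" for V :: "(F3 ^ 'n) set"
  proof -
    have "\<not> V \<subseteq> {0}"
      using dim by (metis vec.dim_eq_0 less_irrefl)
    then have "\<exists>i. \<exists>v\<in>V. v $ i \<noteq> 0"
      by (auto simp: vec_eq_iff)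
    then obtain i where i: "\<exists>v\<in>V. v $ i \<noteq> 0"
      and least: "\<And>j. \<exists>v\<in>V. v $ j \<noteq> 0 \<Longrightarrow> f i \<le> f j"
      using exists_least_iff[of "\<lambda>n. \<exists>i. f i = n \<and> (\<exists>v\<in>V. v $ i \<noteq> 0)"]
      by (metis not_le)
    have below: "x $ j = 0" if "x \<in> V" "f j < f i" for x j
      using least[of j] that by auto
    obtain v where v: "v \<in> V" "v $ i \<noteq> 0"
      using i by blast
    define V1 where "V1 = {x \<in> V. x $ i = 1}"
    have "Im (indicator A x * exp (- 2 * of_real pi * \<i> * of_int (to_int_mod_ring (x $ i)) / 3))
        = (if x \<in> V1 then - sqrt 3 / 2 else 0)" if x: "x \<in> V" for x
    proof -
      consider "x $ i = 0" | "x $ i = 1" | "x $ i \<noteq> 0" "x $ i \<noteq> 1"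
        by blast
      then show ?thesis
      proof cases
        \<comment> \<open>The exponential is 1 here, so the term is real whether or not
          \<open>x\<close> lies in \<open>A\<close>.\<close>
        case 1
        then show ?thesis
          by (simp add: V1_def indicator_def)
      next
        case 2
        then have "x \<in> A"
          using below x by (auto simp: A_def)
        with 2 x show ?thesis
          using Im_exp_third by (simp add: V1_def)
      next
        case 3
        have "x \<notin> A"
        proof
          assume "x \<in> A"
          then obtain j where j: "x $ j = 1" "\<And>k. f k < f j \<Longrightarrow> x $ k = 0"
            by (auto simp: A_def)
          \<comment> \<open>If \<open>f j < f i\<close>, then \<open>x $ j\<close> vanishes by the
            choice of \<open>i\<close>, against \<open>x $ j = 1\<close>. If
            \<open>f i < f j\<close>, then \<open>x $ i\<close> vanishes because \<open>j\<close> is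
            the leading coordinate of \<open>x\<close>, against the case assumption.\<close>
          then have "f j = f i"
            using 3 below[OF x, of j] by (metis linorder_neqE_nat zero_neq_one)
          with f j 3 show False
            by (auto dest: injD)
        qed
        with 3 show ?thesis
          by (simp add: V1_def)
      qed
    qed
    then have "(\<Sum>x\<in>V. Im (indicator A x *
        exp (- 2 * of_real pi * \<i> * of_int (to_int_mod_ring (x $ i)) / 3)))
      = (\<Sum>x\<in>V. if x \<in> V1 then - sqrt 3 / 2 else 0)"
      by (rule sum.cong[OF refl])
    also have "\<dots> = (\<Sum>x\<in>V1. - sqrt 3 / 2)"
      by (rule sum.mono_neutral_cong_right) (auto simp: V1_def)
    finally have sum: "Im (\<Sum>x\<in>V. indicator A x *
        exp (- 2 * of_real pi * \<i> * of_int (to_int_mod_ring (x $ i)) / 3))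
      = real (card V1) * (- sqrt 3 / 2)"
      by (simp only: Im_sum sum_constant)
    have card: "card V = 3 * card V1"
      using card_subspace_coordinate_fibre[OF V v, of 1] CARD_three by (simp add: V1_def)
    have "card V \<noteq> 0"
      using v by auto
    have "Im (fourier_restr A V (axis i 1)) = real (card V1) * (- sqrt 3 / 2) / real (card V)"
      unfolding fourier_restr_def axis_dot sum[symmetric]
      by (simp del: Im_sum)
    also have "\<dots> = - (sqrt 3 / 6)"
      using card \<open>card V \<noteq> 0\<close> by (simp add: field_simps)
    finally have "sqrt 3 / 6 \<le> cmod (fourier_restr A V (axis i 1))"
      using abs_Im_le_cmod[of "fourier_restr A V (axis i 1)"] by simp
    \<comment> \<open>The vector \<open>v\<close> witnesses that \<open>axis i 1\<close> is outside
      \<open>perp V\<close>. The supremum is over a finite set, hence bounded above.\<close>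
    also have "\<dots> \<le> (SUP r \<in> {r. r \<notin> perp V}. cmod (fourier_restr A V r))"
      by (rule cSUP_upper) (use v in \<open>auto simp: perp_def axis_dot\<close>)
    finally show ?thesis .
  qed
  then show ?thesis
    by blast
qed

end
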